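(* For every graph $H$ (connected, with at least three nodes, of constant size) that is not a complete multipartite graph and every $r \geq 1$, the $r$-round bandwidth complexity of $\textsc{MemList}(H)$ under node insertions is $\Omega(n^2/r)$.
   Context: A graph is complete multipartite if its node set can be partitioned into independent sets such that two nodes are adjacent iff they lie in different parts. Dynamic network model: a sequence of graphs $G^0, G^1, \ldots$ with $n$ nodes in total, each obtained from the previous by at most one node insertion (a new node adjacent to an arbitrary subset of existing nodes); nodes have distinct IDs from $[n]$, know their neighbors' IDs and initially the whole of $G^0$; communication is synchronous, each round the change happens first, then each node sends a $B$-bit message to each neighbor; nodes detect changes only via their neighbor lists; algorithms are deterministic. An $r$-round algorithm works under the promise that each change at round $i$ is followed by $r-1$ change-free rounds and must output correctly for $G^i$ by the end of round $i+r-1$. The $r$-round bandwidth complexity is the minimum such $B$. $\textsc{MemList}(H)$: each node $v$ lists all subgraphs isomorphic to $H$ containing $v$. *)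

theory Defs
  imports Main "HOL-Library.Disjoint_Sets" "HOL-Library.Extended_Real"
begin

section \<open>Simple graphs\<close>

type_synonym 'a sgraph = "'a set \<times> 'a set set"

abbreviation verts :: "'a sgraph \<Rightarrow> 'a set" where "verts \<equiv> fst"
abbreviation edges :: "'a sgraph \<Rightarrow> 'a set set" where "edges \<equiv> snd"

definition simple_graph :: "'a sgraph \<Rightarrow> bool" where
  "simple_graph G \<longleftrightarrow> finite (verts G) \<and> (\<forall>e\<in>edges G. e \<subseteq> verts G \<and> card e = 2)"

definition adj :: "'a sgraph \<Rightarrow> 'a \<Rightarrow> 'a \<Rightarrow> bool" where
  "adj G u v \<longleftrightarrow> {u, v} \<in> edges G"

definition nbrs :: "'a sgraph \<Rightarrow> 'a \<Rightarrow> 'a set" where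
  "nbrs G v = {u. adj G v u}"

definition graph_connected :: "'a sgraph \<Rightarrow> bool" where
  "graph_connected G \<longleftrightarrow> verts G \<noteq> {} \<and> (\<forall>u\<in>verts G. \<forall>v\<in>verts G. (adj G)\<^sup>*\<^sup>* u v)"

text \<open>The case \<open>p = q\<close> says that the parts are independent sets.\<close>

definition complete_multipartite :: "'a sgraph \<Rightarrow> bool" where
  "complete_multipartite G \<longleftrightarrow>
     (\<exists>P. partition_on (verts G) P \<and>
          (\<forall>p\<in>P. \<forall>q\<in>P. \<forall>u\<in>p. \<forall>v\<in>q. adj G u v \<longleftrightarrow> p \<noteq> q))"

definition graph_iso :: "'a sgraph \<Rightarrow> 'b sgraph \<Rightarrow> bool" where
  "graph_iso G K \<longleftrightarrow>
     (\<exists>f. bij_betw f (verts G) (verts K) \<and>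
          (\<forall>u\<in>verts G. \<forall>v\<in>verts G. adj G u v \<longleftrightarrow> adj K (f u) (f v)))"

text \<open>Subgraphs need not be induced.\<close>

definition subgraph :: "'a sgraph \<Rightarrow> 'a sgraph \<Rightarrow> bool" where
  "subgraph K G \<longleftrightarrow> simple_graph K \<and> verts K \<subseteq> verts G \<and> edges K \<subseteq> edges G"

definition mem_list :: "'h sgraph \<Rightarrow> 'a sgraph \<Rightarrow> 'a \<Rightarrow> 'a sgraph set" where
  "mem_list H G v = {K. subgraph K G \<and> v \<in> verts K \<and> graph_iso H K}"


section \<open>Dynamic networks with node insertions\<close>

text \<open>Nodes are identified with their IDs.\<close>

type_synonym node = nat
type_synonym network = "nat \<Rightarrow> node sgraph"

definition node_insertion :: "node sgraph \<Rightarrow> node sgraph \<Rightarrow> bool" where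
  "node_insertion G G' \<longleftrightarrow>
     (\<exists>v N. v \<notin> verts G \<and> N \<subseteq> verts G \<and>
        G' = (insert v (verts G), edges G \<union> (\<lambda>u. {v, u}) ` N))"

text \<open>
  A network has \<open>n\<close> nodes in total, with IDs \<open>1, \<dots>, n\<close>: every ID is present from
  the start or inserted at some point. The change of round \<open>Suc t\<close> turns
  \<open>G t\<close> into \<open>G (Suc t)\<close>.
\<close>

definition insertion_network :: "nat \<Rightarrow> network \<Rightarrow> bool" where
  "insertion_network n G \<longleftrightarrow>
     simple_graph (G 0) \<and>
     (\<forall>t. G (Suc t) = G t \<or> node_insertion (G t) (G (Suc t))) \<and>
     (\<Union>t. verts (G t)) = {1..n}"

definition change_at :: "network \<Rightarrow> nat \<Rightarrow> bool" where
  "change_at G i \<longleftrightarrow> 1 \<le> i \<and> G i \<noteq> G (i - 1)"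

text \<open>Rounds \<open>i + 1, \<dots>, i + r - 1\<close> after a change at round \<open>i\<close> are change-free.\<close>

definition change_promise :: "nat \<Rightarrow> network \<Rightarrow> bool" where
  "change_promise r G \<longleftrightarrow> (\<forall>i. change_at G i \<longrightarrow> (\<forall>j\<in>{i<..<i + r}. \<not> change_at G j))"


section \<open>Deterministic distributed algorithms\<close>

type_synonym message = "bool list"

text \<open>
  What a node observes in one round: \<open>None\<close> if it is not yet in the network; otherwise
  its current neighbours and the message received from each of them (\<open>None\<close> for
  non-neighbours). The history of a node after \<open>t\<close> rounds is the list of its \<open>t\<close>
  observations; in particular its length reveals the round number, also to nodes
  inserted later.
\<close>

type_synonym observation = "(node set \<times> (node \<Rightarrow> message option)) option"
type_synonym history = "observation list"

text \<open>
  Nodes have unlimited memory and computational power, so a deterministic algorithm is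
  given by functions of everything that a node knows.
  \<open>send A v G0 h N u\<close> is the message that \<open>v\<close> sends to \<open>u\<close> when the initial graph is \<open>G0\<close>,
  the history of \<open>v\<close> before the current round is \<open>h\<close>, and its current neighbours are \<open>N\<close>.
  \<open>out A v G0 h\<close> is the output of \<open>v\<close> at the end of a round, where \<open>h\<close> includes that round.
\<close>

record dyn_algorithm =
  send :: "node \<Rightarrow> node sgraph \<Rightarrow> history \<Rightarrow> node set \<Rightarrow> node \<Rightarrow> message"
  out :: "node \<Rightarrow> node sgraph \<Rightarrow> history \<Rightarrow> node sgraph set"

primrec hist :: "dyn_algorithm \<Rightarrow> network \<Rightarrow> nat \<Rightarrow> node \<Rightarrow> history" where
  "hist A G 0 = (\<lambda>v. [])"
| "hist A G (Suc t) = (\<lambda>v. hist A G t v @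
     [if v \<in> verts (G (Suc t))
      then Some (nbrs (G (Suc t)) v,
             \<lambda>u. if u \<in> nbrs (G (Suc t)) v
                 then Some (send A u (G 0) (hist A G t u) (nbrs (G (Suc t)) u) v)
                 else None)
      else None])"

definition has_bandwidth :: "dyn_algorithm \<Rightarrow> nat \<Rightarrow> bool" where
  "has_bandwidth A B \<longleftrightarrow> (\<forall>v G0 h N u. length (send A v G0 h N u) = B)"

definition solves_mem_list :: "dyn_algorithm \<Rightarrow> 'h sgraph \<Rightarrow> nat \<Rightarrow> nat \<Rightarrow> bool" where
  "solves_mem_list A H r n \<longleftrightarrow>
     (\<forall>G. insertion_network n G \<and> change_promise r G \<longrightarrow>
        (\<forall>i. change_at G i \<longrightarrow>
           (\<forall>v\<in>verts (G i).
              out A v (G 0) (hist A G (i + r - 1) v) = mem_list H (G i) v)))"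

text \<open>
  The value is \<open>\<infinity>\<close> if there is no \<open>r\<close>-round algorithm of any bandwidth; this
  happens when \<open>r\<close> is too small for a change to reach all nodes of a copy of \<open>H\<close>.
\<close>

definition mem_list_bandwidth :: "'h sgraph \<Rightarrow> nat \<Rightarrow> nat \<Rightarrow> enat" where
  "mem_list_bandwidth H r n =
     Inf {enat B | B. \<exists>A. has_bandwidth A B \<and> solves_mem_list A H r n}"

end

theory Submission imports Defs begin

text \<open>
  As \<open>H\<close> is not complete multipartite, it has an edge \<open>{a, b}\<close> and a further node \<open>c\<close>
  adjacent to neither \<open>a\<close> nor \<open>b\<close>. Replace \<open>a\<close> and \<open>b\<close> by independent sets of about
  \<open>n/2\<close> nodes each, joined by an arbitrary bipartite graph \<open>S\<close>. Start from the empty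
  network and insert the nodes one at a time, \<open>c\<close> last. The copies of \<open>H\<close> through \<open>c\<close>
  determine \<open>S\<close>, so \<open>c\<close> must receive \<open>\<Omega>(n\<^sup>2)\<close> bits in the \<open>r\<close> rounds after its
  insertion; but it has at most \<open>|H|\<close> neighbours, the same ones for every \<open>S\<close>.
\<close>

section \<open>Graphs\<close>

lemma edge_cases:
  assumes "simple_graph G" "e \<in> edges G"
  obtains u v where "e = {u, v}" "u \<noteq> v" "u \<in> verts G" "v \<in> verts G"
  using assms unfolding simple_graph_def by (metis card_2_iff insert_subset)

text \<open>On the nodes of \<open>H\<close>, non-adjacency is reflexive and symmetric. If there
  were no such triple it would be transitive as well, and its equivalence classes would be the parts
  of a complete multipartite graph.\<close>

lemma not_complete_multipartiteE:
  assumes "simple_graph H" "\<not> complete_multipartite H"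
  obtains a b c where "a \<in> verts H" "b \<in> verts H" "c \<in> verts H"
    "adj H a b" "\<not> adj H c a" "\<not> adj H c b"
proof -
  have sym: "adj H u v \<longleftrightarrow> adj H v u" for u v
    by (simp add: adj_def insert_commute)
  have irr: "\<not> adj H u u" for u
    using assms(1) by (auto simp: adj_def simple_graph_def)
  define R where "R = {(u, v). u \<in> verts H \<and> v \<in> verts H \<and> \<not> adj H u v}"
  have "\<exists>a\<in>verts H. \<exists>b\<in>verts H. \<exists>c\<in>verts H. adj H a b \<and> \<not> adj H c a \<and> \<not> adj H c b"
  proof (rule ccontr)
    assume *: "\<not> ?thesis"
    have "equiv (verts H) R"
    proof (rule equivI)
      show "R \<subseteq> verts H \<times> verts H" by (auto simp: R_def)
      show "refl_on (verts H) R" using irr by (auto simp: R_def refl_on_def)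
      show "sym R" using sym by (auto simp: R_def sym_def)
      show "trans R" using * sym unfolding R_def trans_def by blast
    qed
    have "partition_on (verts H) (verts H // R)"
      using \<open>equiv (verts H) R\<close> by (rule partition_on_quotient)
    moreover have "adj H u v \<longleftrightarrow> p \<noteq> q"
      if "p \<in> verts H // R" "q \<in> verts H // R" "u \<in> p" "v \<in> q" for p q u v
    proof -
      have "u \<in> verts H" "v \<in> verts H"
        using that \<open>equiv (verts H) R\<close> by (meson in_quotient_imp_subset subsetD)+
      moreover have "p = q \<longleftrightarrow> (u, v) \<in> R"
        using quotient_eq_iff[OF \<open>equiv (verts H) R\<close> that(1,2,3,4)] .
      ultimately show ?thesis by (auto simp: R_def)
    qed
    ultimately have "complete_multipartite H"
      unfolding complete_multipartite_def by blast
    with assms(2) show False by blast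
  qed
  then show thesis using that by blast
qed

text \<open>Every edge of a simple graph is a pair of its nodes, so taking images under the node
  bijection gives a bijection of the edge sets. This later rules out copies of \<open>H\<close> that
  lack an edge.\<close>

lemma graph_iso_card_edges:
  assumes "graph_iso G K" "simple_graph G" "simple_graph K"
  shows "card (edges G) = card (edges K)"
proof -
  obtain f where f: "bij_betw f (verts G) (verts K)"
    "\<forall>u\<in>verts G. \<forall>v\<in>verts G. adj G u v \<longleftrightarrow> adj K (f u) (f v)"
    using assms(1) by (auto simp: graph_iso_def)
  have sub: "edges G \<subseteq> Pow (verts G)"
    using assms(2) by (auto simp: simple_graph_def)
  have "inj_on ((`) f) (edges G)"
    by (rule inj_on_subset[OF inj_on_image_Pow sub]) (use f in \<open>simp add: bij_betw_def\<close>)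
  moreover have "(`) f ` edges G = edges K"
  proof (intro equalityI subsetI)
    fix e assume "e \<in> (`) f ` edges G"
    then obtain e' where e': "e' \<in> edges G" "e = f ` e'" by auto
    obtain u v where "e' = {u, v}" "u \<in> verts G" "v \<in> verts G"
      using edge_cases[OF assms(2) e'(1)] by metis
    with e' f(2) show "e \<in> edges K"
      by (auto simp: adj_def)
  next
    fix e assume "e \<in> edges K"
    then obtain u v where uv: "e = {u, v}" "u \<in> verts K" "v \<in> verts K"
      using edge_cases[OF assms(3)] by metis
    then obtain u' v' where "u' \<in> verts G" "v' \<in> verts G" "u = f u'" "v = f v'"
      using f(1) unfolding bij_betw_def by (metis imageE)
    with uv \<open>e \<in> edges K\<close> f(2) have "{u', v'} \<in> edges G" "e = f ` {u', v'}"
      by (auto simp: adj_def)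
    then show "e \<in> (`) f ` edges G" by blast
  qed
  ultimately show ?thesis by (metis card_image)
qed


section \<open>Inserting the nodes of a graph one by one\<close>

definition induced :: "'a sgraph \<Rightarrow> 'a set \<Rightarrow> 'a sgraph" where
  "induced F W = (W, {e \<in> edges F. e \<subseteq> W})"

text \<open>For \<open>r \<ge> 1\<close>, ID \<open>x\<close> arrives in round \<open>x * r\<close>,
  so insertions are \<open>r\<close> rounds apart and \<open>min n\<close> stops them after the last
  ID. The initial graph is empty for simple \<open>F\<close>, so it reveals nothing about
  \<open>F\<close>.\<close>

definition node_by_node :: "nat \<Rightarrow> nat \<Rightarrow> node sgraph \<Rightarrow> network" where
  "node_by_node r n F t = induced F {1..min n (t div r)}"

lemma node_insertion_induced:
  assumes "simple_graph F" "v \<notin> W"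
  shows "node_insertion (induced F W) (induced F (insert v W))"
proof -
  define N where "N = {u \<in> W. {v, u} \<in> edges F}"
  have "{e \<in> edges F. e \<subseteq> insert v W} = {e \<in> edges F. e \<subseteq> W} \<union> (\<lambda>u. {v, u}) ` N"
  proof (intro equalityI subsetI)
    fix e assume e: "e \<in> {e \<in> edges F. e \<subseteq> insert v W}"
    then obtain x y where "e = {x, y}" "x \<noteq> y"
      using edge_cases[OF assms(1)] by (metis mem_Collect_eq)
    with e show "e \<in> {e \<in> edges F. e \<subseteq> W} \<union> (\<lambda>u. {v, u}) ` N"
      by (auto simp: N_def insert_commute)
  qed (auto simp: N_def)
  then show ?thesis
    unfolding node_insertion_def induced_def
    by (intro exI[of _ v] exI[of _ N]) (use assms(2) in \<open>auto simp: N_def\<close>)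
qed

lemma node_by_node_0:
  assumes "simple_graph F"
  shows "node_by_node r n F 0 = ({}, {})"
  using assms by (auto simp: node_by_node_def induced_def simple_graph_def)

lemma node_by_node_final:
  assumes "simple_graph F" "verts F = {1..n}" "r \<ge> 1" "n * r \<le> t"
  shows "node_by_node r n F t = F"
proof -
  have "n \<le> t div r"
    using assms(3,4) by (simp add: less_eq_div_iff_mult_less_eq)
  moreover have "\<forall>e\<in>edges F. e \<subseteq> {1..n}"
    using assms(1,2) by (auto simp: simple_graph_def)
  ultimately show ?thesis
    using assms(2) by (auto simp: node_by_node_def induced_def prod_eq_iff min_def)
qed

text \<open>The quotient \<open>t div r\<close> grows, by one, exactly when \<open>r\<close> divides
  \<open>Suc t\<close>. Recording this divisibility is what yields the promise on the spacing of
  changes.\<close>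

lemma node_by_node_step:
  assumes "simple_graph F"
  shows "node_by_node r n F (Suc t) = node_by_node r n F t \<or>
    node_insertion (node_by_node r n F t) (node_by_node r n F (Suc t)) \<and> r dvd Suc t"
proof (cases "Suc t mod r = 0 \<and> t div r < n")
  case True
  then have "Suc t div r = Suc (t div r)" by (simp add: div_Suc)
  with True have "{1..min n (Suc t div r)} = insert (Suc (t div r)) {1..min n (t div r)}"
    by auto
  then show ?thesis
    using node_insertion_induced[OF assms, of "Suc (t div r)" "{1..min n (t div r)}"] True
    by (auto simp: node_by_node_def)
next
  case False
  then show ?thesis by (auto simp: node_by_node_def div_Suc min_def)
qed

lemma insertion_network_node_by_node:
  assumes "simple_graph F" "verts F = {1..n}" "r \<ge> 1"
  shows "insertion_network n (node_by_node r n F)"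
  unfolding insertion_network_def
proof (intro conjI allI)
  show "simple_graph (node_by_node r n F 0)"
    by (simp add: node_by_node_0[OF assms(1)] simple_graph_def)
  show "node_by_node r n F (Suc t) = node_by_node r n F t \<or>
      node_insertion (node_by_node r n F t) (node_by_node r n F (Suc t))" for t
    using node_by_node_step[OF assms(1)] by blast
  have "verts (node_by_node r n F (n * r)) = {1..n}"
    using node_by_node_final[OF assms] assms(2) by simp
  then show "(\<Union>t. verts (node_by_node r n F t)) = {1..n}"
    by (fastforce simp: node_by_node_def induced_def)
qed

text \<open>Changes occur only in rounds divisible by \<open>r\<close>, and two distinct multiples
  of \<open>r\<close> are at least \<open>r\<close> apart.\<close>

lemma change_promise_node_by_node:
  assumes "simple_graph F"
  shows "change_promise r (node_by_node r n F)"
proof -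
  have "r dvd i" if "change_at (node_by_node r n F) i" for i
    using that node_by_node_step[OF assms, of r n "i - 1"] by (auto simp: change_at_def)
  moreover have "\<not> r dvd j" if "r dvd i" "i < j" "j < i + r" for i j
  proof
    assume "r dvd j"
    then have "r dvd j - i" using \<open>r dvd i\<close> by (rule dvd_diff_nat)
    then have "r \<le> j - i" using that by (intro dvd_imp_le) auto
    then show False using that by simp
  qed
  ultimately show ?thesis
    unfolding change_promise_def by (metis greaterThanLessThan_iff)
qed

lemma change_at_last_insertion:
  assumes "simple_graph F" "verts F = {1..n}" "r \<ge> 1" "n \<ge> 1"
  shows "change_at (node_by_node r n F) (n * r)"
proof -
  have "(n * r - 1) div r < n"
    using assms(3,4) by (simp add: div_less_iff_less_mult)
  then have "n \<notin> verts (node_by_node r n F (n * r - 1))"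
    by (auto simp: node_by_node_def induced_def)
  moreover have "n \<in> verts (node_by_node r n F (n * r))"
    using node_by_node_final[OF assms(1,2,3)] assms(2,4) by simp
  ultimately show ?thesis
    using assms(3,4) by (auto simp: change_at_def Suc_le_eq)
qed


section \<open>What the last inserted node learns\<close>

text \<open>What a present node with fixed neighbourhood \<open>N\<close> can see in one round: only
  the messages vary. Extensional functions represent each assignment of messages to \<open>N\<close>
  once, which bounds the count by \<open>2 ^ (B * card N)\<close>.\<close>

definition observations :: "node set \<Rightarrow> nat \<Rightarrow> observation set" where
  "observations N B =
     (\<lambda>m. Some (N, \<lambda>u. if u \<in> N then Some (m u) else None)) `
       (N \<rightarrow>\<^sub>E {l. length l = B})"

lemma finite_card_observations:
  assumes "finite N"
  shows "finite (observations N B)" "card (observations N B) \<le> 2 ^ (B * card N)"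
proof -
  have fin: "finite {l :: message. length l = B}" and
    crd: "card {l :: message. length l = B} = 2 ^ B"
    using finite_lists_length_eq[of "UNIV :: bool set" B]
      card_lists_length_eq[of "UNIV :: bool set" B] by simp_all
  have fin': "finite (N \<rightarrow>\<^sub>E {l :: message. length l = B})"
    using assms fin by (intro finite_PiE) auto
  then show "finite (observations N B)" by (simp add: observations_def)
  have "card (observations N B) \<le> card (N \<rightarrow>\<^sub>E {l :: message. length l = B})"
    unfolding observations_def using fin' by (rule card_image_le)
  also have "\<dots> = 2 ^ (B * card N)"
    using assms by (simp add: card_PiE crd power_mult)
  finally show "card (observations N B) \<le> 2 ^ (B * card N)" .
qed

text \<open>The \<open>t\<close> rounds of absence form a constant prefix, so only the
  \<open>j\<close> rounds of presence contribute to the count.\<close>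

definition late_histories :: "node set \<Rightarrow> nat \<Rightarrow> nat \<Rightarrow> nat \<Rightarrow> history set" where
  "late_histories N B t j =
     (\<lambda>l. replicate t None @ l) ` {l. set l \<subseteq> observations N B \<and> length l = j}"

lemma finite_card_late_histories:
  assumes "finite N"
  shows "finite (late_histories N B t j)"
    "card (late_histories N B t j) \<le> 2 ^ (B * card N * j)"
proof -
  note obs = finite_card_observations[OF assms, of B]
  have fin: "finite {l. set l \<subseteq> observations N B \<and> length l = j}"
    using obs(1) by (rule finite_lists_length_eq)
  then show "finite (late_histories N B t j)" by (simp add: late_histories_def)
  have "card (late_histories N B t j) \<le> card (observations N B) ^ j"
    unfolding late_histories_def using card_image_le[OF fin] card_lists_length_eq[OF obs(1)]
    by metis
  also have "\<dots> \<le> (2 ^ (B * card N)) ^ j" using obs(2) by (rule power_mono) simp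
  finally show "card (late_histories N B t j) \<le> 2 ^ (B * card N * j)"
    by (simp add: power_mult)
qed

lemma hist_absent:
  assumes "\<And>s. s \<le> t \<Longrightarrow> v \<notin> verts (G s)"
  shows "hist A G t v = replicate t None"
  using assms by (induction t) (simp_all add: replicate_append_same)

lemma hist_late:
  assumes "has_bandwidth A B"
    and "\<And>s. s \<le> t \<Longrightarrow> v \<notin> verts (G s)"
    and "\<And>s. t < s \<Longrightarrow> v \<in> verts (G s) \<and> nbrs (G s) v = N"
  shows "hist A G (t + j) v \<in> late_histories N B t j"
proof (induction j)
  case 0
  then show ?case
    unfolding late_histories_def
    by (intro image_eqI[of _ _ "[]"]) (simp_all add: hist_absent[OF assms(2)])
next
  case (Suc j)
  \<comment> \<open>Restricting to \<open>N\<close> makes the message assignment extensional; the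
    observation does not change, since it reads \<open>m\<close> on \<open>N\<close> only.\<close>
  define m where
    "m = restrict (\<lambda>u. send A u (G 0) (hist A G (t + j) u) (nbrs (G (Suc (t + j))) u) v) N"
  define x :: observation where "x = Some (N, \<lambda>u. if u \<in> N then Some (m u) else None)"
  have "m \<in> N \<rightarrow>\<^sub>E {l. length l = B}"
    using assms(1) unfolding m_def has_bandwidth_def
    by (intro restrict_PiE_iff[THEN iffD2]) blast
  then have x: "x \<in> observations N B" by (auto simp: x_def observations_def)
  obtain l where l: "hist A G (t + j) v = replicate t None @ l"
      "set l \<subseteq> observations N B" "length l = j"
    using Suc.IH by (auto simp: late_histories_def)
  have "hist A G (t + Suc j) v = hist A G (t + j) v @ [x]"
    using assms(3)[of "Suc (t + j)"] by (auto simp: x_def m_def fun_eq_iff)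
  then have "hist A G (t + Suc j) v = replicate t None @ (l @ [x])"
    using l(1) by simp
  then show ?case
    unfolding late_histories_def using l x by (intro image_eqI) auto
qed

text \<open>Node \<open>n\<close> arrives in round \<open>n * r\<close> and must answer by the end
  of round \<open>n * r + r - 1\<close>. It is thus absent for \<open>n * r - 1\<close> rounds and
  present for exactly \<open>r\<close>, during which the network is already
  \<open>F\<close>.\<close>

lemma hist_last_inserted:
  assumes "has_bandwidth A B" "simple_graph F" "verts F = {1..n}" "r \<ge> 1" "n \<ge> 1"
  shows "hist A (node_by_node r n F) (n * r + r - 1) n
    \<in> late_histories (nbrs F n) B (n * r - 1) r"
proof -
  have "hist A (node_by_node r n F) (n * r - 1 + r) n
    \<in> late_histories (nbrs F n) B (n * r - 1) r"
  proof (rule hist_late[OF assms(1)])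
    fix s assume "s \<le> n * r - 1"
    then have "s < n * r" using assms(4,5) by (simp add: Suc_le_eq le_diff_conv2)
    then have "s div r < n" using assms(4) by (simp add: div_less_iff_less_mult)
    then show "n \<notin> verts (node_by_node r n F s)"
      by (auto simp: node_by_node_def induced_def)
  next
    fix s assume "n * r - 1 < s"
    then have "n * r \<le> s" by linarith
    then show "n \<in> verts (node_by_node r n F s) \<and> nbrs (node_by_node r n F s) n = nbrs F n"
      using node_by_node_final[OF assms(2,3,4)] assms(3,5) by simp
  qed
  moreover have "n * r - 1 + r = n * r + r - 1"
    using assms(4,5) by simp
  ultimately show ?thesis by simp
qed

text \<open>A counting argument: all networks of the family start from the same empty graph, so the
  output of \<open>n\<close> depends on its history alone. Different lists force different
  histories, of which there are at most \<open>2 ^ (B * card N * r)\<close>.\<close>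

lemma card_family_le_bandwidth:
  fixes F :: "'i \<Rightarrow> node sgraph"
  assumes alg: "has_bandwidth A B" "solves_mem_list A H r n"
    and F: "\<And>S. S \<in> I \<Longrightarrow> simple_graph (F S)" "\<And>S. S \<in> I \<Longrightarrow> verts (F S) = {1..n}"
      "\<And>S. S \<in> I \<Longrightarrow> nbrs (F S) n = N"
    and N: "finite N" and "r \<ge> 1" "n \<ge> 1"
    and inj: "inj_on (\<lambda>S. mem_list H (F S) n) I"
  shows "card I \<le> 2 ^ (B * card N * r)"
proof -
  define h where "h S = hist A (node_by_node r n (F S)) (n * r + r - 1) n" for S
  have out: "out A n ({}, {}) (h S) = mem_list H (F S) n" if "S \<in> I" for S
  proof -
    note F' = F(1,2)[OF that]
    have "out A n (node_by_node r n (F S) 0) (h S)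
        = mem_list H (node_by_node r n (F S) (n * r)) n"
      using alg(2) insertion_network_node_by_node[OF F' \<open>r \<ge> 1\<close>]
        change_promise_node_by_node[OF F'(1)] change_at_last_insertion[OF F' \<open>r \<ge> 1\<close> \<open>n \<ge> 1\<close>]
        node_by_node_final[OF F' \<open>r \<ge> 1\<close> order.refl] F'(2) \<open>n \<ge> 1\<close>
      unfolding solves_mem_list_def h_def by force
    then show ?thesis
      using node_by_node_0[OF F'(1)] node_by_node_final[OF F' \<open>r \<ge> 1\<close> order.refl] by simp
  qed
  have "inj_on h I"
  proof (rule inj_onI)
    fix S T assume "S \<in> I" "T \<in> I" "h S = h T"
    then have "mem_list H (F S) n = mem_list H (F T) n" using out by metis
    then show "S = T" using inj \<open>S \<in> I\<close> \<open>T \<in> I\<close> by (auto dest: inj_onD)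
  qed
  moreover have "h ` I \<subseteq> late_histories N B (n * r - 1) r"
    using hist_last_inserted[OF alg(1) F(1,2) \<open>r \<ge> 1\<close> \<open>n \<ge> 1\<close>] F(3) unfolding h_def by fastforce
  ultimately have "card I \<le> card (late_histories N B (n * r - 1) r)"
    using finite_card_late_histories(1)[OF N] by (metis card_inj_on_le)
  also have "\<dots> \<le> 2 ^ (B * card N * r)"
    using finite_card_late_histories(2)[OF N] .
  finally show ?thesis .
qed


section \<open>Blowing up an edge\<close>

text \<open>The map \<open>\<pi>\<close> sends each network node to the node of \<open>H\<close>
  that it replaces. Every node of \<open>H\<close> other than \<open>a\<close> and \<open>b\<close>
  has exactly one preimage, while the fibres over \<open>a\<close> and \<open>b\<close> may have any
  size; the last ID plays the role of \<open>c\<close>.\<close>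

locale edge_blow_up =
  fixes H :: "'h sgraph" and a b c :: 'h and n :: nat and \<pi> :: "node \<Rightarrow> 'h"
  assumes H: "simple_graph H"
    and c: "c \<in> verts H"
    and ab: "adj H a b" and ca: "\<not> adj H c a" and cb: "\<not> adj H c b"
    and \<pi>: "\<pi> ` {1..n} \<subseteq> verts H" "verts H - {a, b} \<subseteq> \<pi> ` {1..n}"
    and inj: "inj_on \<pi> {x \<in> {1..n}. \<pi> x \<notin> {a, b}}"
    and n: "n \<ge> 1" "\<pi> n = c"
begin

definition core :: "node set" where "core = {x \<in> {1..n}. \<pi> x \<notin> {a, b}}"

definition fibre :: "'h \<Rightarrow> node set" where "fibre w = {x \<in> {1..n}. \<pi> x = w}"

text \<open>All edges of \<open>H\<close> except \<open>{a, b}\<close> are pulled back along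
  \<open>\<pi>\<close>; between the fibres over \<open>a\<close> and \<open>b\<close> the free
  bipartite graph \<open>S\<close> takes the place of the pulled-back edge.\<close>

definition blown_up :: "(node \<times> node) set \<Rightarrow> node sgraph" where
  "blown_up S = ({1..n},
     {{x, y} | x y. x \<in> {1..n} \<and> y \<in> {1..n} \<and>
        {\<pi> x, \<pi> y} \<in> edges H \<and> {\<pi> x, \<pi> y} \<noteq> {a, b}} \<union>
     (\<lambda>(x, y). {x, y}) ` S)"

lemma neq: "a \<noteq> b" "c \<noteq> a" "c \<noteq> b"
proof -
  show "a \<noteq> b" using ab H by (auto simp: adj_def simple_graph_def)
  show "c \<noteq> a" using ab cb by auto
  show "c \<noteq> b" using ab ca by (auto simp: adj_def insert_commute)
qed

lemma verts_ab: "a \<in> verts H" "b \<in> verts H"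
  using ab H by (auto simp: adj_def simple_graph_def)

lemma finite_edges_H: "finite (edges H)"
  using H by (auto simp: simple_graph_def intro: finite_subset[of _ "Pow (verts H)"])

lemma verts_blown_up [simp]: "verts (blown_up S) = {1..n}"
  by (simp add: blown_up_def)

lemma simple_blown_up:
  assumes "S \<subseteq> fibre a \<times> fibre b"
  shows "simple_graph (blown_up S)"
proof -
  have 1: "card {x, y} = 2" if "{\<pi> x, \<pi> y} \<in> edges H" for x y
  proof -
    have "card {\<pi> x, \<pi> y} = 2" using that H by (auto simp: simple_graph_def)
    then have "x \<noteq> y" by auto
    then show ?thesis by simp
  qed
  have 2: "card {x, y} = 2" if "x \<in> fibre a" "y \<in> fibre b" for x y
    using that neq by (auto simp: fibre_def card_2_iff)
  show ?thesis
    unfolding simple_graph_def blown_up_def using 1 2 assms by (auto simp: fibre_def)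
qed

text \<open>The right-hand side does not mention \<open>S\<close>: node \<open>n\<close> lies over
  \<open>c\<close>, which is neither \<open>a\<close> nor \<open>b\<close>, so no edge of
  \<open>S\<close> contains it. Hence the neighbourhood of the last node carries no information
  about \<open>S\<close>.\<close>

lemma nbrs_blown_up:
  assumes "S \<subseteq> fibre a \<times> fibre b"
  shows "nbrs (blown_up S) n = {x \<in> {1..n}. {c, \<pi> x} \<in> edges H}"
proof -
  have "{n, x} \<in> edges (blown_up S) \<longleftrightarrow> x \<in> {1..n} \<and> {c, \<pi> x} \<in> edges H" for x
  proof
    assume "{n, x} \<in> edges (blown_up S)"
    moreover have "{n, x} \<noteq> {u, v}" if "u \<in> fibre a" "v \<in> fibre b" for u v
      using that n neq by (auto simp: fibre_def doubleton_eq_iff)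
    ultimately obtain u v where "{n, x} = {u, v}" "u \<in> {1..n}" "v \<in> {1..n}" "{\<pi> u, \<pi> v} \<in> edges H"
      using assms unfolding blown_up_def by fastforce
    then show "x \<in> {1..n} \<and> {c, \<pi> x} \<in> edges H"
      using n by (auto simp: doubleton_eq_iff insert_commute)
  next
    assume *: "x \<in> {1..n} \<and> {c, \<pi> x} \<in> edges H"
    moreover have "{c, \<pi> x} \<noteq> {a, b}" using neq by (auto simp: doubleton_eq_iff)
    ultimately have "n \<in> {1..n} \<and> x \<in> {1..n} \<and> {\<pi> n, \<pi> x} \<in> edges H \<and> {\<pi> n, \<pi> x} \<noteq> {a, b}"
      using n by simp
    then show "{n, x} \<in> edges (blown_up S)"
      unfolding blown_up_def by auto
  qed
  then show ?thesis by (auto simp: nbrs_def adj_def)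
qed

text \<open>As \<open>c\<close> is adjacent to neither \<open>a\<close> nor \<open>b\<close>, the
  neighbours of the last node avoid the two large fibres, and \<open>\<pi>\<close> is injective on
  them. Their number stays bounded as \<open>n\<close> grows.\<close>

lemma card_nbrs_le: "card {x \<in> {1..n}. {c, \<pi> x} \<in> edges H} \<le> card (verts H)"
proof (rule card_inj_on_le)
  have "{x \<in> {1..n}. {c, \<pi> x} \<in> edges H} \<subseteq> {x \<in> {1..n}. \<pi> x \<notin> {a, b}}"
    using ca cb by (auto simp: adj_def)
  then show "inj_on \<pi> {x \<in> {1..n}. {c, \<pi> x} \<in> edges H}"
    using inj by (rule inj_on_subset[rotated])
  show "\<pi> ` {x \<in> {1..n}. {c, \<pi> x} \<in> edges H} \<subseteq> verts H" using \<pi>(1) by auto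
  show "finite (verts H)" using H by (simp add: simple_graph_def)
qed

section \<open>Copies of \<open>H\<close> on transversals of the fibres\<close>

lemma bij_transversal:
  assumes "x \<in> fibre a" "y \<in> fibre b"
  shows "bij_betw \<pi> (core \<union> {x, y}) (verts H)"
  unfolding bij_betw_def
proof
  show "inj_on \<pi> (core \<union> {x, y})"
    using inj assms neq unfolding core_def fibre_def inj_on_def by auto
  show "\<pi> ` (core \<union> {x, y}) = verts H"
  proof
    show "\<pi> ` (core \<union> {x, y}) \<subseteq> verts H"
      using \<pi>(1) assms unfolding core_def fibre_def by auto
    show "verts H \<subseteq> \<pi> ` (core \<union> {x, y})"
    proof
      fix w assume "w \<in> verts H"
      with \<pi>(2) consider "w = a" | "w = b" | u where "u \<in> {1..n}" "w = \<pi> u" "w \<notin> {a, b}"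
        by blast
      then show "w \<in> \<pi> ` (core \<union> {x, y})"
        by cases (use assms in \<open>auto simp: core_def fibre_def\<close>)
    qed
  qed
qed

text \<open>The nodes \<open>core \<union> {x, y}\<close> meet the two large fibres in
  \<open>x\<close> and \<open>y\<close> only, so \<open>(x, y)\<close> is the only pair of
  \<open>S\<close> that matters. Via \<open>\<pi>\<close> the blown-up graph looks there like
  \<open>H\<close> if \<open>(x, y) \<in> S\<close>, and like \<open>H\<close> without the edge
  \<open>{a, b}\<close> otherwise.\<close>

lemma edge_in_transversal:
  assumes S: "S \<subseteq> fibre a \<times> fibre b" and xy: "x \<in> fibre a" "y \<in> fibre b"
    and uv: "u \<in> core \<union> {x, y}" "v \<in> core \<union> {x, y}"
  shows "{u, v} \<in> edges (blown_up S) \<longleftrightarrow>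
    {\<pi> u, \<pi> v} \<in> edges H \<and> ({\<pi> u, \<pi> v} = {a, b} \<longrightarrow> (x, y) \<in> S)"
proof
  assume "{u, v} \<in> edges (blown_up S)"
  then consider (H) u' v' where "{u, v} = {u', v'}" "{\<pi> u', \<pi> v'} \<in> edges H" "{\<pi> u', \<pi> v'} \<noteq> {a, b}"
    | (S) u' v' where "{u, v} = {u', v'}" "(u', v') \<in> S"
    unfolding blown_up_def by auto
  then show "{\<pi> u, \<pi> v} \<in> edges H \<and> ({\<pi> u, \<pi> v} = {a, b} \<longrightarrow> (x, y) \<in> S)"
  proof cases
    case H
    then have "{\<pi> u, \<pi> v} = {\<pi> u', \<pi> v'}" by (auto simp: doubleton_eq_iff)
    with H show ?thesis by simp
  next
    case (S u' v')
    then have "u' \<in> fibre a" "v' \<in> fibre b" using \<open>S \<subseteq> fibre a \<times> fibre b\<close> by auto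
    moreover have "u' \<in> core \<union> {x, y}" "v' \<in> core \<union> {x, y}"
      using S(1) uv by (auto simp: doubleton_eq_iff)
    ultimately have "u' = x" "v' = y"
      using xy neq by (auto simp: core_def fibre_def)
    moreover have "{\<pi> u, \<pi> v} = {\<pi> u', \<pi> v'}" using S(1) by (auto simp: doubleton_eq_iff)
    ultimately show ?thesis
      using S(2) xy ab by (auto simp: fibre_def adj_def)
  qed
next
  assume *: "{\<pi> u, \<pi> v} \<in> edges H \<and> ({\<pi> u, \<pi> v} = {a, b} \<longrightarrow> (x, y) \<in> S)"
  show "{u, v} \<in> edges (blown_up S)"
  proof (cases "{\<pi> u, \<pi> v} = {a, b}")
    case True
    then have "{u, v} = {x, y}"
      using uv xy neq by (auto simp: core_def fibre_def doubleton_eq_iff)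
    moreover have "(x, y) \<in> S" using True * by simp
    ultimately show ?thesis unfolding blown_up_def by force
  next
    case False
    moreover have "u \<in> {1..n}" "v \<in> {1..n}"
      using uv xy by (auto simp: core_def fibre_def)
    ultimately show ?thesis using * unfolding blown_up_def by auto
  qed
qed

text \<open>If \<open>(x, y) \<in> S\<close>, the graph induced on the transversal is itself a copy
  of \<open>H\<close> through \<open>n\<close>. Otherwise every subgraph on these nodes has fewer
  edges than \<open>H\<close>.\<close>

lemma mem_list_transversal_iff:
  assumes S: "S \<subseteq> fibre a \<times> fibre b" and xy: "x \<in> fibre a" "y \<in> fibre b"
  shows "(\<exists>K\<in>mem_list H (blown_up S) n. verts K = core \<union> {x, y}) \<longleftrightarrow> (x, y) \<in> S"
proof
  let ?W = "core \<union> {x, y}"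
  note bij = bij_transversal[OF xy]
  note iff = edge_in_transversal[OF S xy]
  have W: "?W \<subseteq> {1..n}" using xy by (auto simp: core_def fibre_def)
  {
    assume "(x, y) \<in> S"
    define K where "K = induced (blown_up S) ?W"
    have "subgraph K (blown_up S)"
      using simple_blown_up[OF S] W
      by (auto simp: K_def subgraph_def induced_def simple_graph_def intro: finite_subset)
    moreover have "n \<in> verts K"
      using n neq by (auto simp: K_def induced_def core_def)
    moreover have "graph_iso H K"
      unfolding graph_iso_def
    proof (intro exI conjI ballI)
      show "bij_betw (inv_into ?W \<pi>) (verts H) (verts K)"
        using bij_betw_inv_into[OF bij] by (simp add: K_def induced_def)
      fix u v assume uv: "u \<in> verts H" "v \<in> verts H"
      define u' v' where "u' = inv_into ?W \<pi> u" and "v' = inv_into ?W \<pi> v"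
      have "u' \<in> ?W" "v' \<in> ?W" "\<pi> u' = u" "\<pi> v' = v"
        using uv bij inv_into_into[of _ \<pi> ?W] f_inv_into_f[of _ \<pi> ?W]
        unfolding u'_def v'_def bij_betw_def by metis+
      then show "adj H u v \<longleftrightarrow> adj K (inv_into ?W \<pi> u) (inv_into ?W \<pi> v)"
        using iff[of u' v'] \<open>(x, y) \<in> S\<close> unfolding u'_def[symmetric] v'_def[symmetric]
        by (simp add: adj_def K_def induced_def)
    qed
    ultimately show "\<exists>K\<in>mem_list H (blown_up S) n. verts K = ?W"
      by (intro bexI[of _ K]) (auto simp: mem_list_def K_def induced_def)
  }
  {
    assume "\<exists>K\<in>mem_list H (blown_up S) n. verts K = ?W"
    then obtain K where K: "simple_graph K" "edges K \<subseteq> edges (blown_up S)" "graph_iso H K"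
        "verts K = ?W"
      by (auto simp: mem_list_def subgraph_def)
    show "(x, y) \<in> S"
    proof (rule ccontr)
      assume "(x, y) \<notin> S"
      \<comment> \<open>The isomorphism from \<open>H\<close> to \<open>K\<close> is arbitrary and
        need not invert \<open>\<pi>\<close>, so the contradiction comes from counting edges:
        \<open>\<pi>\<close> embeds the edges of \<open>K\<close> into those of \<open>H\<close>
        other than \<open>{a, b}\<close>.\<close>
      have "(`) \<pi> ` edges K \<subseteq> edges H - {{a, b}}"
      proof
        fix e' assume "e' \<in> (`) \<pi> ` edges K"
        then obtain e where e: "e \<in> edges K" "e' = \<pi> ` e" by blast
        obtain u v where "e = {u, v}" "u \<in> ?W" "v \<in> ?W"
          using edge_cases[OF K(1) e(1)] K(4) by metis
        then show "e' \<in> edges H - {{a, b}}"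
          using iff[of u v] e K(2) \<open>(x, y) \<notin> S\<close> by auto
      qed
      moreover have "inj_on ((`) \<pi>) (edges K)"
      proof (rule inj_on_subset[OF inj_on_image_Pow])
        show "inj_on \<pi> ?W" using bij by (simp add: bij_betw_def)
        show "edges K \<subseteq> Pow ?W" using K(1,4) by (auto simp: simple_graph_def)
      qed
      ultimately have "card (edges K) \<le> card (edges H - {{a, b}})"
        using finite_edges_H by (intro card_inj_on_le) auto
      also have "\<dots> < card (edges H)"
        using finite_edges_H ab by (intro card_Diff1_less) (auto simp: adj_def)
      finally show False using graph_iso_card_edges[OF K(3) H K(1)] by simp
    qed
  }
qed

lemma inj_mem_list:
  "inj_on (\<lambda>S. mem_list H (blown_up S) n) (Pow (fibre a \<times> fibre b))"
proof (rule inj_onI)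
  fix S T assume *: "S \<in> Pow (fibre a \<times> fibre b)" "T \<in> Pow (fibre a \<times> fibre b)"
    "mem_list H (blown_up S) n = mem_list H (blown_up T) n"
  have "(x, y) \<in> S \<longleftrightarrow> (x, y) \<in> T" if "x \<in> fibre a" "y \<in> fibre b" for x y
    using mem_list_transversal_iff[of S x y] mem_list_transversal_iff[of T x y] * that by simp
  then show "S = T" using * by auto
qed

text \<open>There are \<open>2 ^ (card (fibre a) * card (fibre b))\<close> choices of
  \<open>S\<close>, each with its own list at node \<open>n\<close>; the claim compares exponents
  with the number of histories.\<close>

lemma bandwidth_ge:
  assumes "has_bandwidth A B" "solves_mem_list A H r n" "r \<ge> 1"
  shows "card (fibre a) * card (fibre b) \<le> B * card (verts H) * r"
proof -
  let ?N = "{x \<in> {1..n}. {c, \<pi> x} \<in> edges H}"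
  have "card (Pow (fibre a \<times> fibre b)) \<le> 2 ^ (B * card ?N * r)"
    using assms(1,2) simple_blown_up nbrs_blown_up assms(3) n(1) inj_mem_list
    by (intro card_family_le_bandwidth[where F = blown_up and H = H and n = n]) auto
  then have "(2::nat) ^ (card (fibre a) * card (fibre b)) \<le> 2 ^ (B * card ?N * r)"
    by (simp add: card_Pow card_cartesian_product fibre_def)
  then have "card (fibre a) * card (fibre b) \<le> B * card ?N * r"
    by (simp only: power_increasing_iff one_less_numeral_iff semiring_norm)
  also have "\<dots> \<le> B * card (verts H) * r"
    using card_nbrs_le by (intro mult_le_mono) auto
  finally show ?thesis .
qed

end

section \<open>Realising the blow-up on the IDs \<open>{1..n}\<close>\<close>

lemma edge_blow_up_exists:
  assumes H: "simple_graph H" and abc: "a \<in> verts H" "b \<in> verts H" "c \<in> verts H"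
    and adj: "adj H a b" "\<not> adj H c a" "\<not> adj H c b"
    and n: "n \<ge> card (verts H) + 2 * m"
  obtains \<pi> where "edge_blow_up H a b c n \<pi>"
    "card (edge_blow_up.fibre n \<pi> a) \<ge> m" "card (edge_blow_up.fibre n \<pi> b) \<ge> m"
proof -
  have neq: "a \<noteq> b" "c \<noteq> a" "c \<noteq> b"
    using adj H by (auto simp: adj_def simple_graph_def insert_commute)
  have fin: "finite (verts H)" using H by (simp add: simple_graph_def)
  define k where "k = card (verts H - {a, b, c})"
  have card: "card (verts H) = k + 3"
  proof -
    have "card {a, b, c} = 3" using neq by auto
    moreover have "card {a, b, c} \<le> card (verts H)" using abc fin by (intro card_mono) auto
    ultimately show ?thesis
      unfolding k_def using abc fin by (subst card_Diff_subset) auto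
  qed
  obtain e where e: "bij_betw e {1..k} (verts H - {a, b, c})"
    using ex_bij_betw_nat_finite_1[of "verts H - {a, b, c}"] fin k_def by auto
  \<comment> \<open>The first \<open>k\<close> IDs stand for the nodes of \<open>H\<close> other
    than \<open>a\<close>, \<open>b\<close>, \<open>c\<close>, the next \<open>m\<close> for
    \<open>a\<close>, all others below \<open>n\<close> for \<open>b\<close>, and \<open>n\<close>
    itself for \<open>c\<close>. As \<open>n \<ge> k + 2 * m + 3\<close>, at least \<open>m\<close>
    IDs are left for \<open>b\<close>.\<close>
  define \<pi> where
    "\<pi> x = (if x = n then c else if x \<le> k then e x else if x \<le> k + m then a else b)" for x
  have eV: "e x \<in> verts H" "e x \<noteq> a" "e x \<noteq> b" "e x \<noteq> c" if "1 \<le> x" "x \<le> k" for x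
    using that bij_betwE[OF e] by auto
  have nk: "k + 2 * m + 3 \<le> n" using n card by simp
  have "\<pi> x \<notin> {a, b} \<longleftrightarrow> x \<in> insert n {1..k}" if "x \<in> {1..n}" for x
    using that neq eV(2,3)[of x] by (simp add: \<pi>_def)
  then have "{x \<in> {1..n}. \<pi> x \<notin> {a, b}} = {x \<in> {1..n}. x \<in> insert n {1..k}}"
    by blast
  also have "\<dots> = insert n {1..k}" using nk by auto
  finally have core: "{x \<in> {1..n}. \<pi> x \<notin> {a, b}} = insert n {1..k}" .
  have loc: "edge_blow_up H a b c n \<pi>"
  proof
    show "\<pi> ` {1..n} \<subseteq> verts H" using eV abc by (auto simp: \<pi>_def)
    show "verts H - {a, b} \<subseteq> \<pi> ` {1..n}"
    proof
      fix w assume w: "w \<in> verts H - {a, b}"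
      show "w \<in> \<pi> ` {1..n}"
      proof (cases "w = c")
        case True
        then show ?thesis using nk by (intro image_eqI[of _ _ n]) (auto simp: \<pi>_def)
      next
        case False
        with w have "w \<in> e ` {1..k}" unfolding bij_betw_imp_surj_on[OF e] by blast
        then obtain x where "x \<in> {1..k}" "w = e x" by blast
        then show ?thesis using nk by (intro image_eqI[of _ _ x]) (auto simp: \<pi>_def)
      qed
    qed
    show "inj_on \<pi> {x \<in> {1..n}. \<pi> x \<notin> {a, b}}"
    proof -
      have e': "\<pi> x = e x" if "x \<in> {1..k}" for x
        using that nk by (simp add: \<pi>_def)
      have "inj_on \<pi> {1..k}"
        using bij_betw_imp_inj_on[OF e] inj_on_cong[of "{1..k}" \<pi> e] e' by blast
      moreover have "\<pi> n \<notin> \<pi> ` ({1..k} - {n})"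
      proof
        assume "\<pi> n \<in> \<pi> ` ({1..k} - {n})"
        then obtain x where "x \<in> {1..k}" "\<pi> x = \<pi> n" by force
        then show False using e'[of x] eV(4)[of x] by (simp add: \<pi>_def)
      qed
      ultimately show ?thesis unfolding core inj_on_insert by blast
    qed
    show "n \<ge> 1" using nk by simp
    show "\<pi> n = c" by (simp add: \<pi>_def)
  qed fact+
  interpret edge_blow_up H a b c n \<pi> by (fact loc)
  have "{k + 1..k + m} \<subseteq> fibre a" using nk by (auto simp: fibre_def \<pi>_def)
  then have "card {k + 1..k + m} \<le> card (fibre a)"
    by (rule card_mono[rotated]) (simp add: fibre_def)
  moreover have "{k + m + 1..k + m + m} \<subseteq> fibre b" using nk by (auto simp: fibre_def \<pi>_def)
  then have "card {k + m + 1..k + m + m} \<le> card (fibre b)"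
    by (rule card_mono[rotated]) (simp add: fibre_def)
  ultimately show thesis using that[OF loc] by simp
qed


section \<open>The lower bound\<close>

text \<open>An infimum in \<open>enat\<close> is \<open>\<infinity>\<close> for the empty set, where
  the bound is trivial, and is attained otherwise, so bounding every algorithm's bandwidth
  suffices.\<close>

lemma le_mem_list_bandwidth:
  assumes "\<And>A B. has_bandwidth A B \<Longrightarrow> solves_mem_list A H r n \<Longrightarrow> x \<le> real B"
  shows "ereal x \<le> ereal_of_enat (mem_list_bandwidth H r n)"
proof -
  let ?X = "{enat B | B. \<exists>A. has_bandwidth A B \<and> solves_mem_list A H r n}"
  show ?thesis
  proof (cases "?X = {}")
    case True
    then show ?thesis unfolding mem_list_bandwidth_def True by (simp add: Inf_enat_def)
  next
    case False
    then have "mem_list_bandwidth H r n \<in> ?X"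
      unfolding mem_list_bandwidth_def Inf_enat_def
      by (simp only: if_False) (metis (mono_tags, lifting) LeastI ex_in_conv)
    then show ?thesis using assms by auto
  qed
qed

theorem theorem5p9:
  fixes H :: "'h sgraph"
  assumes "simple_graph H" and "graph_connected H" and "card (verts H) \<ge> 3"
    and "\<not> complete_multipartite H"
  shows "\<exists>c::real. c > 0 \<and> (\<exists>n0::nat. \<forall>n\<ge>n0. \<forall>r::nat. r \<ge> 1 \<longrightarrow>
           ereal (c * (real n)^2 / real r) \<le> ereal_of_enat (mem_list_bandwidth H r n))"
proof -
  obtain a b c where abc: "a \<in> verts H" "b \<in> verts H" "c \<in> verts H"
      "adj H a b" "\<not> adj H c a" "\<not> adj H c b"
    using not_complete_multipartiteE[OF assms(1,4)] by metis
  let ?h = "card (verts H)"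
  show ?thesis
  proof (intro exI conjI allI impI)
    \<comment> \<open>The 16 comes from \<open>n \<le> 4 * m\<close> for fibres of size at least
      \<open>m\<close>; the factor \<open>?h\<close> bounds the number of neighbours of the last
      node.\<close>
    show "1 / (16 * real ?h) > 0" using assms(3) by simp
    fix n r :: nat assume n: "2 * ?h + 4 \<le> n" and r: "r \<ge> 1"
    \<comment> \<open>The largest \<open>m\<close> with \<open>?h + 2 * m \<le> n\<close>; the
      threshold on \<open>n\<close> ensures that it is at least a quarter of
      \<open>n\<close>.\<close>
    define m where "m = (n - ?h) div 2"
    have m: "n \<le> 4 * m" "?h + 2 * m \<le> n" using n unfolding m_def by linarith+
    show "ereal (1 / (16 * real ?h) * (real n)^2 / real r)
        \<le> ereal_of_enat (mem_list_bandwidth H r n)"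
    proof (rule le_mem_list_bandwidth)
      fix A B assume alg: "has_bandwidth A B" "solves_mem_list A H r n"
      obtain \<pi> where \<pi>: "edge_blow_up H a b c n \<pi>"
          "m \<le> card (edge_blow_up.fibre n \<pi> a)" "m \<le> card (edge_blow_up.fibre n \<pi> b)"
        using edge_blow_up_exists[OF assms(1) abc m(2)] by metis
      have "n ^ 2 \<le> (4 * m) ^ 2" using m(1) by (rule power_mono) simp
      also have "\<dots> = 16 * (m * m)" by (simp add: power2_eq_square)
      also have "m * m \<le> B * ?h * r"
        using mult_le_mono[OF \<pi>(2,3)] edge_blow_up.bandwidth_ge[OF \<pi>(1) alg r] by linarith
      finally have "n ^ 2 \<le> 16 * (B * ?h * r)" by simp
      then have "real (n ^ 2) \<le> real (16 * (B * ?h * r))" by (rule of_nat_mono)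
      then show "1 / (16 * real ?h) * (real n)^2 / real r \<le> real B"
        using r assms(3) by (simp add: field_simps)
    qed
  qed
qed

end
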